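(* Consider the forest fire model on $\mathbb{Z}_+$ with instant spread ($\Delta\equiv 0$) and burning time distribution $\theta\ge 0$. Then almost surely there are no infinite fires.
   Context: Forest fire model with instant spread on $\mathbb{Z}_+=\{0,1,2,\dots\}$. Let $\theta$ be a non-negative (finite-valued) random variable and $\theta_{x,i}$ ($x\ge0$, $i\ge1$) i.i.d. copies of it, independent of tree appearances. Each site is vacant, occupied by a non-burning tree, or occupied by a burning tree; all sites are vacant at time $0$. At each vacant site a tree appears after an $\exp(1)$ time, independently of everything else. There is a constant source of fire at site $0$: a tree appearing at $0$ starts burning immediately. If the tree at $x$ starts burning for the $i$-th time at time $f_{x,i}$, it burns during a time $\theta_{x,i}$, after which $x$ becomes vacant. Spread: if at time $t=f_{x,i}$ there is a non-burning tree at $x+1$, it starts burning at time $t$. Otherwise, if the next tree at $x+1$ appears at time $t+\nu$, $\nu>0$, it starts burning immediately at time $t+\nu$ if $\nu<\theta_{x,i}$, while if $\nu\ge\theta_{x,i}$ this fire does not propagate beyond $x$. While a site is burning, no tree grows there and no fire can spread to it from the left. The $k$-th fire is the one started by the $k$-th burning of site $0$, together with all burnings successively ignited by it. A fire is infinite if it burns sites arbitrarily far from the origin, i.e. it never stops but continues to infinity. *)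

theory Defs
  imports "HOL-Probability.Probability"
begin

text \<open>
  The model is built from waiting times \<open>\<tau> x i\<close> and burning times \<open>\<theta> x i\<close>. Trees at a site only
  disappear by burning, so the \<open>i\<close>-th tree at \<open>x\<close> is also the one involved in the \<open>i\<close>-th burning
  of \<open>x\<close>; it appears \<open>\<tau> x i\<close> after \<open>x\<close> became vacant for the last time and, if it ever ignites,
  burns for \<open>\<theta> x i\<close>. Indices \<open>i\<close> start at 0 here, so index \<open>i\<close> is the \<open>(i + 1)\<close>-st tree.
  Times are extended reals, \<open>\<infinity>\<close> meaning ``never''.
\<close>

text \<open>
  Consider one tree, appearing at time \<open>a\<close>, whose predecessor at the same site ignited at time \<open>p\<close>
  (\<open>p = -\<infinity>\<close> if there is none). The left neighbour starts burning at times \<open>F i\<close>, for durations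
  \<open>T i\<close>. The tree is the non-burning tree present at time \<open>F i\<close>, or else the next one to appear,
  only if \<open>p < F i\<close>: if \<open>F i \<le> p\<close>, that role belongs to an earlier tree. Hence every
  burning of the left neighbour can ignite at most one tree.
\<close>

definition spreads :: "ereal \<Rightarrow> ereal \<Rightarrow> ereal \<Rightarrow> real \<Rightarrow> bool" where
  "spreads p a t d \<longleftrightarrow> p < t \<and> t \<noteq> \<infinity> \<and> (a \<le> t \<or> a < t + ereal d)"

definition igniter :: "(nat \<Rightarrow> ereal) \<Rightarrow> (nat \<Rightarrow> real) \<Rightarrow> ereal \<Rightarrow> ereal \<Rightarrow> nat option" where
  "igniter F T p a =
     (if \<exists>i. spreads p a (F i) (T i) then Some (LEAST i. spreads p a (F i) (T i)) else None)"

definition ignition_time :: "(nat \<Rightarrow> ereal) \<Rightarrow> (nat \<Rightarrow> real) \<Rightarrow> ereal \<Rightarrow> ereal \<Rightarrow> ereal" where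
  "ignition_time F T p a = (case igniter F T p a of None \<Rightarrow> \<infinity> | Some i \<Rightarrow> max a (F i))"

primrec source_burn :: "(nat \<Rightarrow> real) \<Rightarrow> (nat \<Rightarrow> real) \<Rightarrow> nat \<Rightarrow> ereal" where
  "source_burn \<tau> \<theta> 0 = ereal (\<tau> 0)"
| "source_burn \<tau> \<theta> (Suc i) = source_burn \<tau> \<theta> i + ereal (\<theta> i) + ereal (\<tau> (Suc i))"

primrec next_burn ::
  "(nat \<Rightarrow> ereal) \<Rightarrow> (nat \<Rightarrow> real) \<Rightarrow> (nat \<Rightarrow> real) \<Rightarrow> (nat \<Rightarrow> real) \<Rightarrow> nat \<Rightarrow> ereal" where
  "next_burn F T \<tau> \<theta> 0 = ignition_time F T (-\<infinity>) (ereal (\<tau> 0))"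
| "next_burn F T \<tau> \<theta> (Suc j) =
     ignition_time F T (next_burn F T \<tau> \<theta> j)
       (next_burn F T \<tau> \<theta> j + ereal (\<theta> j) + ereal (\<tau> (Suc j)))"

text \<open>
  \<open>burn \<tau> \<theta> x i\<close> is the time at which \<open>x\<close> starts burning for the \<open>(i + 1)\<close>-st time, that is
  \<open>f\<^sub>x\<^sub>,\<^sub>i\<^sub>+\<^sub>1\<close>.
\<close>

primrec burn :: "(nat \<Rightarrow> nat \<Rightarrow> real) \<Rightarrow> (nat \<Rightarrow> nat \<Rightarrow> real) \<Rightarrow> nat \<Rightarrow> nat \<Rightarrow> ereal" where
  "burn \<tau> \<theta> 0 = source_burn (\<tau> 0) (\<theta> 0)"
| "burn \<tau> \<theta> (Suc x) = next_burn (burn \<tau> \<theta> x) (\<theta> x) (\<tau> (Suc x)) (\<theta> (Suc x))"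

definition prev_burn :: "(nat \<Rightarrow> nat \<Rightarrow> real) \<Rightarrow> (nat \<Rightarrow> nat \<Rightarrow> real) \<Rightarrow> nat \<Rightarrow> nat \<Rightarrow> ereal" where
  "prev_burn \<tau> \<theta> x i = (case i of 0 \<Rightarrow> -\<infinity> | Suc j \<Rightarrow> burn \<tau> \<theta> x j)"

definition appear :: "(nat \<Rightarrow> nat \<Rightarrow> real) \<Rightarrow> (nat \<Rightarrow> nat \<Rightarrow> real) \<Rightarrow> nat \<Rightarrow> nat \<Rightarrow> ereal" where
  "appear \<tau> \<theta> x i =
     (case i of 0 \<Rightarrow> ereal (\<tau> x 0)
      | Suc j \<Rightarrow> burn \<tau> \<theta> x j + ereal (\<theta> x j) + ereal (\<tau> x (Suc j)))"

text \<open>The \<open>i\<close>-th burning of \<open>x\<close> ignites the \<open>j\<close>-th tree of \<open>x + 1\<close>.\<close>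

definition ignites ::
  "(nat \<Rightarrow> nat \<Rightarrow> real) \<Rightarrow> (nat \<Rightarrow> nat \<Rightarrow> real) \<Rightarrow> nat \<Rightarrow> nat \<Rightarrow> nat \<Rightarrow> bool" where
  "ignites \<tau> \<theta> x i j \<longleftrightarrow>
     igniter (burn \<tau> \<theta> x) (\<theta> x) (prev_burn \<tau> \<theta> (Suc x) j) (appear \<tau> \<theta> (Suc x) j) = Some i"

inductive_set fire :: "(nat \<Rightarrow> nat \<Rightarrow> real) \<Rightarrow> (nat \<Rightarrow> nat \<Rightarrow> real) \<Rightarrow> nat \<Rightarrow> (nat \<times> nat) set"
  for \<tau> \<theta> :: "nat \<Rightarrow> nat \<Rightarrow> real" and k :: nat where
  start: "(0, k) \<in> fire \<tau> \<theta> k"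
| spread: "(x, i) \<in> fire \<tau> \<theta> k \<Longrightarrow> ignites \<tau> \<theta> x i j \<Longrightarrow> (Suc x, j) \<in> fire \<tau> \<theta> k"

definition infinite_fire :: "(nat \<Rightarrow> nat \<Rightarrow> real) \<Rightarrow> (nat \<Rightarrow> nat \<Rightarrow> real) \<Rightarrow> nat \<Rightarrow> bool" where
  "infinite_fire \<tau> \<theta> k \<longleftrightarrow> (\<forall>n. \<exists>x\<ge>n. \<exists>i. (x, i) \<in> fire \<tau> \<theta> k)"

text \<open>
  The remaining lemmas confirm that the construction obeys the dynamics: the source tree burns
  as soon as it appears, and the spread rule holds in its forward form, where the burning
  \<open>(x, i)\<close> concerns the first tree \<open>j\<close> at \<open>x + 1\<close> that has not ignited before time \<open>burn \<tau> \<theta> x i\<close>.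
\<close>

lemma burn_source: "burn \<tau> \<theta> 0 i = appear \<tau> \<theta> 0 i"
  by (cases i) (simp_all add: appear_def)

lemma burn_Suc:
  "burn \<tau> \<theta> (Suc x) j =
     ignition_time (burn \<tau> \<theta> x) (\<theta> x) (prev_burn \<tau> \<theta> (Suc x) j) (appear \<tau> \<theta> (Suc x) j)"
  by (cases j) (simp_all add: appear_def prev_burn_def)

declare burn.simps [simp del]

lemma burn_Suc_None: "(\<And>i. \<not> ignites \<tau> \<theta> x i j) \<Longrightarrow> burn \<tau> \<theta> (Suc x) j = \<infinity>"
  by (simp add: burn_Suc ignition_time_def ignites_def split: option.split)

lemma ignitesD:
  assumes "ignites \<tau> \<theta> x i j"
  shows "spreads (prev_burn \<tau> \<theta> (Suc x) j) (appear \<tau> \<theta> (Suc x) j) (burn \<tau> \<theta> x i) (\<theta> x i)"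
    and "burn \<tau> \<theta> (Suc x) j = max (appear \<tau> \<theta> (Suc x) j) (burn \<tau> \<theta> x i)"
proof -
  show "spreads (prev_burn \<tau> \<theta> (Suc x) j) (appear \<tau> \<theta> (Suc x) j) (burn \<tau> \<theta> x i) (\<theta> x i)"
    using assms unfolding ignites_def igniter_def by (auto split: if_splits intro: LeastI)
  show "burn \<tau> \<theta> (Suc x) j = max (appear \<tau> \<theta> (Suc x) j) (burn \<tau> \<theta> x i)"
    using assms by (simp add: burn_Suc ignition_time_def ignites_def)
qed

locale fire_env =
  fixes \<tau> \<theta> :: "nat \<Rightarrow> nat \<Rightarrow> real"
  assumes tau_pos: "\<And>x i. 0 < \<tau> x i" and theta_nonneg: "\<And>x i. 0 \<le> \<theta> x i"
begin

lemma appear_le_burn: "appear \<tau> \<theta> x j \<le> burn \<tau> \<theta> x j"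
proof (cases x)
  case (Suc y)
  then show ?thesis
    by (cases "\<exists>i. ignites \<tau> \<theta> y i j") (auto simp: ignitesD(2) burn_Suc_None)
qed (simp add: burn_source)

lemma burn_gap: "burn \<tau> \<theta> x j + ereal (\<theta> x j) + ereal (\<tau> x (Suc j)) \<le> burn \<tau> \<theta> x (Suc j)"
  using appear_le_burn[of x "Suc j"] by (simp add: appear_def)

lemma burn_nonneg: "0 \<le> burn \<tau> \<theta> x j"
proof (induction j)
  case 0
  show ?case
    using appear_le_burn[of x 0] tau_pos[of x 0]
    by (cases "burn \<tau> \<theta> x 0") (auto simp: appear_def)
next
  case (Suc j)
  have "0 \<le> burn \<tau> \<theta> x j + ereal (\<theta> x j) + ereal (\<tau> x (Suc j))"
    using Suc tau_pos[of x "Suc j"] theta_nonneg[of x j] by simp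
  then show ?case using burn_gap order_trans by blast
qed

lemma burn_mono: "i \<le> j \<Longrightarrow> burn \<tau> \<theta> x i \<le> burn \<tau> \<theta> x j"
proof (rule lift_Suc_mono_le[of "burn \<tau> \<theta> x"])
  fix n
  show "burn \<tau> \<theta> x n \<le> burn \<tau> \<theta> x (Suc n)"
    using burn_gap[of x n] tau_pos[of x "Suc n"] theta_nonneg[of x n] burn_nonneg[of x n]
    by (cases "burn \<tau> \<theta> x n"; cases "burn \<tau> \<theta> x (Suc n)") auto
qed

lemma burn_end_less:
  assumes "i < j" "burn \<tau> \<theta> x i \<noteq> \<infinity>"
  shows "burn \<tau> \<theta> x i + ereal (\<theta> x i) < burn \<tau> \<theta> x j"
proof -
  have "burn \<tau> \<theta> x i + ereal (\<theta> x i) < burn \<tau> \<theta> x (Suc i)"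
    using burn_gap[of x i] tau_pos[of x "Suc i"] burn_nonneg[of x i] assms(2)
    by (cases "burn \<tau> \<theta> x i"; cases "burn \<tau> \<theta> x (Suc i)") auto
  also have "\<dots> \<le> burn \<tau> \<theta> x j" using assms(1) by (intro burn_mono) simp
  finally show ?thesis .
qed

lemma burn_less: "i < j \<Longrightarrow> burn \<tau> \<theta> x i \<noteq> \<infinity> \<Longrightarrow> burn \<tau> \<theta> x i < burn \<tau> \<theta> x j"
  using burn_end_less[of i j x] theta_nonneg[of x i]
  by (cases "burn \<tau> \<theta> x i"; cases "burn \<tau> \<theta> x j") auto

lemma ex_current_tree:
  assumes t: "burn \<tau> \<theta> x i \<noteq> \<infinity>"
  shows "\<exists>j. burn \<tau> \<theta> x i \<le> burn \<tau> \<theta> (Suc x) j \<and> (\<forall>j'<j. burn \<tau> \<theta> (Suc x) j' < burn \<tau> \<theta> x i)"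
proof -
  have "\<exists>j. burn \<tau> \<theta> x i \<le> burn \<tau> \<theta> (Suc x) j"
  proof (rule ccontr)
    assume "\<nexists>j. burn \<tau> \<theta> x i \<le> burn \<tau> \<theta> (Suc x) j"
    then have less: "burn \<tau> \<theta> (Suc x) j < burn \<tau> \<theta> x i" for j by (simp add: not_le)
    have "\<exists>l. ignites \<tau> \<theta> x l j" for j
    proof (rule ccontr)
      assume "\<nexists>l. ignites \<tau> \<theta> x l j"
      then have "burn \<tau> \<theta> (Suc x) j = \<infinity>" by (intro burn_Suc_None) simp
      with less[of j] show False by simp
    qed
    then obtain g where g: "\<And>j. ignites \<tau> \<theta> x (g j) j" by metis
    have le: "burn \<tau> \<theta> x (g j) \<le> burn \<tau> \<theta> (Suc x) j" for j by (simp add: ignitesD(2)[OF g])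
    have "g j < g (Suc j)" for j
    proof -
      have "burn \<tau> \<theta> (Suc x) j < burn \<tau> \<theta> x (g (Suc j))"
        using ignitesD(1)[OF g[of "Suc j"]] by (simp add: spreads_def prev_burn_def)
      with le[of j] have "burn \<tau> \<theta> x (g j) < burn \<tau> \<theta> x (g (Suc j))" by (rule le_less_trans)
      then show ?thesis using burn_mono[of "g (Suc j)" "g j" x] by (auto simp: not_le[symmetric])
    qed
    then have "strict_mono g" by (simp add: strict_mono_Suc_iff)
    then have "i \<le> g i" by (rule strict_mono_imp_increasing)
    then show False using burn_mono[of i "g i" x] le[of i] less[of i] by (meson leD order_trans)
  qed
  then show ?thesis
    using exists_least_iff[of "\<lambda>j. burn \<tau> \<theta> x i \<le> burn \<tau> \<theta> (Suc x) j"] by (simp add: not_le)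
qed

lemma spread_rule:
  assumes t: "burn \<tau> \<theta> x i \<noteq> \<infinity>"
    and j: "burn \<tau> \<theta> x i \<le> burn \<tau> \<theta> (Suc x) j" "\<forall>j'<j. burn \<tau> \<theta> (Suc x) j' < burn \<tau> \<theta> x i"
  shows "appear \<tau> \<theta> (Suc x) j \<le> burn \<tau> \<theta> x i \<Longrightarrow>
           ignites \<tau> \<theta> x i j \<and> burn \<tau> \<theta> (Suc x) j = burn \<tau> \<theta> x i"
    and "\<lbrakk>burn \<tau> \<theta> x i < appear \<tau> \<theta> (Suc x) j;
           appear \<tau> \<theta> (Suc x) j < burn \<tau> \<theta> x i + ereal (\<theta> x i)\<rbrakk> \<Longrightarrow>
           ignites \<tau> \<theta> x i j \<and> burn \<tau> \<theta> (Suc x) j = appear \<tau> \<theta> (Suc x) j"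
    and "\<lbrakk>burn \<tau> \<theta> x i < appear \<tau> \<theta> (Suc x) j;
           burn \<tau> \<theta> x i + ereal (\<theta> x i) \<le> appear \<tau> \<theta> (Suc x) j\<rbrakk> \<Longrightarrow> \<not> ignites \<tau> \<theta> x i j'"
    and "ignites \<tau> \<theta> x i j' \<Longrightarrow> j' = j"
proof -
  let ?p = "prev_burn \<tau> \<theta> (Suc x) j" and ?a = "appear \<tau> \<theta> (Suc x) j"
  have prev: "?p < burn \<tau> \<theta> x i"
    using j(2) burn_nonneg[of x i] by (cases j) (auto simp: prev_burn_def)
  have *: "ignites \<tau> \<theta> x i j"
    if "?a \<le> burn \<tau> \<theta> x i \<or> ?a < burn \<tau> \<theta> x i + ereal (\<theta> x i)"
  proof -
    have sp: "spreads ?p ?a (burn \<tau> \<theta> x i) (\<theta> x i)" using prev t that by (simp add: spreads_def)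
    then have "igniter (burn \<tau> \<theta> x) (\<theta> x) ?p ?a =
        Some (LEAST i. spreads ?p ?a (burn \<tau> \<theta> x i) (\<theta> x i))"
      by (auto simp: igniter_def)
    moreover have "(LEAST i. spreads ?p ?a (burn \<tau> \<theta> x i) (\<theta> x i)) \<le> i" using sp by (rule Least_le)
    ultimately obtain l where l: "ignites \<tau> \<theta> x l j" "l \<le> i" unfolding ignites_def by blast
    have "l = i"
    proof (rule ccontr)
      assume "l \<noteq> i"
      with l(2) have li: "l < i" by simp
      from ignitesD(1)[OF l(1)] have s: "burn \<tau> \<theta> x l \<noteq> \<infinity>"
        "?a \<le> burn \<tau> \<theta> x l \<or> ?a < burn \<tau> \<theta> x l + ereal (\<theta> x l)" by (auto simp: spreads_def)
      have "?a < burn \<tau> \<theta> x i"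
        using s burn_less[OF li s(1)] burn_end_less[OF li s(1)] by (auto dest: order.strict_trans)
      then have "max ?a (burn \<tau> \<theta> x l) < burn \<tau> \<theta> x i" using burn_less[OF li s(1)] by simp
      then show False using j(1) ignitesD(2)[OF l(1)] by (metis not_le)
    qed
    with l show ?thesis by simp
  qed
  show uniq: "j' = j" if "ignites \<tau> \<theta> x i j'" for j'
  proof (rule ccontr)
    assume "j' \<noteq> j"
    then consider "j' < j" | "j < j'" by linarith
    then show False
    proof cases
      case 1
      then show ?thesis using j(2) ignitesD(2)[OF that] by auto
    next
      case 2
      then obtain m where m: "j' = Suc m" "j \<le> m" by (cases j') auto
      have "burn \<tau> \<theta> (Suc x) m < burn \<tau> \<theta> x i"
        using ignitesD(1)[OF that] m(1) by (simp add: spreads_def prev_burn_def)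
      then show ?thesis using j(1) burn_mono[OF m(2), of "Suc x"] by (meson leD order_trans)
    qed
  qed
  show "ignites \<tau> \<theta> x i j \<and> burn \<tau> \<theta> (Suc x) j = burn \<tau> \<theta> x i" if "?a \<le> burn \<tau> \<theta> x i"
    using * ignitesD(2)[of \<tau> \<theta> x i j] that by (simp add: max_absorb2)
  show "ignites \<tau> \<theta> x i j \<and> burn \<tau> \<theta> (Suc x) j = ?a"
    if "burn \<tau> \<theta> x i < ?a" "?a < burn \<tau> \<theta> x i + ereal (\<theta> x i)"
    using * ignitesD(2)[of \<tau> \<theta> x i j] that by (simp add: max_absorb1)
  show "\<not> ignites \<tau> \<theta> x i j'"
    if "burn \<tau> \<theta> x i < ?a" "burn \<tau> \<theta> x i + ereal (\<theta> x i) \<le> ?a"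
  proof
    assume ig: "ignites \<tau> \<theta> x i j'"
    then have "ignites \<tau> \<theta> x i j" using uniq by blast
    from ignitesD(1)[OF this] that show False by (auto simp: spreads_def)
  qed
qed

end

end

theory Submission
  imports Defs
begin

text \<open>
  Consider the first infinite fire. The earlier ones are finite and fires never overtake each
  other, so beyond some site \<open>X\<close> it only burns trees of index \<open>0\<close>. Hence, for some \<open>m\<close>,
  every \<open>x \<ge> X\<close> has \<open>\<tau> (x + 1) 0 \<le> max m (\<tau> (X + 1) 0, \<dots>, \<tau> x 0) + \<theta> x 0\<close>, an event about an
  i.i.d. sequence of pairs. Let \<open>\<phi> m\<close> be its probability and \<open>s\<close> the supremum of \<open>\<phi>\<close>. Choose
  \<open>c \<ge> 0\<close> with \<open>p = P(\<theta> \<le> c) > 0\<close>. Conditioning on the first pair,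
  \<open>\<phi> m \<le> (1 - e\<^sup>-\<^sup>m) \<phi> m + (e\<^sup>-\<^sup>m - e\<^sup>-\<^sup>m\<^sup>-\<^sup>c p) s\<close>, so \<open>\<phi> m \<le> (1 - e\<^sup>-\<^sup>c p) s\<close> and thus \<open>s = 0\<close>.
\<close>

section \<open>Unbroken runs\<close>

text \<open>A pair holds the burning time of a site and the waiting time of its right neighbour, so
  pairs of different sites share no variable. If a fire runs through first trees only and
  \<open>m\<close> bounds its time at the initial site, the value at \<open>n\<close> bounds its
  time \<open>n\<close> sites further right.\<close>

primrec running_max :: "real \<Rightarrow> (real \<times> real) stream \<Rightarrow> nat \<Rightarrow> real" where
  "running_max m s 0 = m"
| "running_max m s (Suc n) = max (running_max m s n) (snd (s !! n))"

text \<open>Only a necessary condition for spreading: for nonnegative burning times, both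
  alternatives in \<open>spreads\<close> imply this single weak inequality.\<close>

definition unbroken :: "real \<Rightarrow> (real \<times> real) stream \<Rightarrow> bool" where
  "unbroken m s \<longleftrightarrow> (\<forall>n. snd (s !! n) \<le> running_max m s n + fst (s !! n))"

lemma running_max_Stream:
  "running_max m (y ## s) (Suc n) = running_max (max m (snd y)) s n"
  by (induction n) simp_all

text \<open>Dropping the first pair leaves a run of the same kind at a possibly higher level, which
  is what makes conditioning on the first pair useful.\<close>

lemma unbroken_Stream:
  "unbroken m (y ## s) \<longleftrightarrow> snd y \<le> m + fst y \<and> unbroken (max m (snd y)) s"
  (is "?L \<longleftrightarrow> ?R")
proof
  assume L: ?L
  have "snd (s !! n) \<le> running_max (max m (snd y)) s n + fst (s !! n)" for n
    using L[unfolded unbroken_def, rule_format, of "Suc n"] running_max_Stream[of m y s n] by simp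
  then show ?R
    using L[unfolded unbroken_def, rule_format, of 0] by (simp add: unbroken_def)
next
  assume R: ?R
  show ?L
    unfolding unbroken_def
  proof
    fix n
    show "snd ((y ## s) !! n) \<le> running_max m (y ## s) n + fst ((y ## s) !! n)"
    proof (cases n)
      case (Suc k)
      then show ?thesis
        using R running_max_Stream[of m y s k] by (simp add: unbroken_def)
    qed (use R in simp)
  qed
qed

section \<open>Probability of an unbroken run\<close>

lemma measurable_running_max [measurable]:
  "(\<lambda>s. running_max m s n) \<in> borel_measurable (stream_space (borel \<Otimes>\<^sub>M borel))"
  by (induction n) simp_all

lemma measurable_unbroken [measurable]:
  "Measurable.pred (stream_space (borel \<Otimes>\<^sub>M borel)) (unbroken m)"
  unfolding unbroken_def by measurable

text \<open>Memorylessness makes the factor independent of \<open>m\<close>: given that the second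
  component exceeds \<open>m\<close>, the first pair has first component at most \<open>c\<close>
  and second component above \<open>m + c\<close>, hence breaks the run, with probability
  \<open>p * exp (-c)\<close>. Here \<open>s\<close> is any common bound, later the
  supremum.\<close>

lemma prob_unbroken_le:
  fixes D :: "(real \<times> real) measure"
  assumes "prob_space D" and sets_D [measurable_cong]: "sets D = sets (borel \<Otimes>\<^sub>M borel)"
    and tail: "\<And>a. 0 \<le> a \<Longrightarrow> measure D {y. a < snd y} = exp (-a)"
    and joint: "\<And>a. 0 \<le> a \<Longrightarrow> measure D {y. fst y \<le> c \<and> a < snd y} = p * exp (-a)"
    and "0 \<le> c" "0 \<le> m"
    and s: "\<And>m. 0 \<le> m \<Longrightarrow> measure (stream_space D) {\<omega> \<in> space (stream_space D). unbroken m \<omega>} \<le> s"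
  shows "measure (stream_space D) {\<omega> \<in> space (stream_space D). unbroken m \<omega>} \<le> (1 - p * exp (-c)) * s"
proof -
  interpret D: prob_space D by fact
  interpret S: prob_space "stream_space D" by (rule D.prob_space_stream_space)
  let ?S = "stream_space D"
  let ?E = "\<lambda>m. {\<omega> \<in> space ?S. unbroken m \<omega>}"
  let ?\<phi> = "\<lambda>m. measure ?S (?E m)"
  have space_D [simp]: "space D = UNIV"
    using sets_eq_imp_space_eq[OF sets_D] by (simp add: space_pair_measure)
  have s0: "0 \<le> s" using s[OF \<open>0 \<le> m\<close>] measure_nonneg order_trans by blast
  define A where "A = {y :: real \<times> real. snd y \<le> m}"
  define G where "G = {y :: real \<times> real. m < snd y}"
  define H where "H = {y :: real \<times> real. fst y \<le> c \<and> m + c < snd y}"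
  have "{y \<in> space D. snd y \<le> m} \<in> sets D" "{y \<in> space D. m < snd y} \<in> sets D"
    "{y \<in> space D. fst y \<le> c \<and> m + c < snd y} \<in> sets D"
    by measurable
  then have [measurable]: "A \<in> sets D" "G \<in> sets D" "H \<in> sets D"
    by (simp_all add: A_def G_def H_def)
  have "H \<subseteq> G" using \<open>0 \<le> c\<close> by (auto simp: H_def G_def)
  have mG: "measure D G = exp (-m)" using tail[OF \<open>0 \<le> m\<close>] by (simp add: G_def)
  have mA: "measure D A = 1 - exp (-m)"
  proof -
    have "A = space D - G" by (auto simp: A_def G_def)
    then show ?thesis using mG by (simp add: D.prob_compl del: space_D)
  qed
  have mH: "measure D H = p * exp (-(m + c))"
    unfolding H_def using \<open>0 \<le> c\<close> \<open>0 \<le> m\<close> by (intro joint) simp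
  have mGH: "measure D (G - H) = exp (-m) - p * exp (-(m + c))"
    unfolding mG[symmetric] mH[symmetric]
    using \<open>H \<subseteq> G\<close> by (intro D.finite_measure_Diff) measurable
  \<comment> \<open>On \<open>A\<close> the level stays \<open>m\<close> and the same event recurs;
    on \<open>H\<close> the run breaks at once, so there is no term; on \<open>G - H\<close> the
    level rises to \<open>snd y\<close>, where the bound \<open>s\<close> applies.\<close>
  have step: "emeasure ?S {\<omega> \<in> space ?S. y ## \<omega> \<in> ?E m}
      \<le> ennreal (?\<phi> m) * indicator A y + ennreal s * indicator (G - H) y" for y
  proof -
    consider "y \<in> A" | "y \<in> H" | "y \<in> G - H"
      unfolding A_def G_def by (cases "snd y \<le> m") auto
    then show ?thesis
    proof cases
      case 1
      then have "{\<omega> \<in> space ?S. y ## \<omega> \<in> ?E m} \<subseteq> ?E m"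
        by (auto simp: unbroken_Stream A_def max_absorb1)
      then have "emeasure ?S {\<omega> \<in> space ?S. y ## \<omega> \<in> ?E m} \<le> ennreal (?\<phi> m)"
        unfolding S.emeasure_eq_measure[symmetric] by (rule emeasure_mono) measurable
      then show ?thesis using 1 by (simp add: A_def G_def)
    next
      case 2
      then have "{\<omega> \<in> space ?S. y ## \<omega> \<in> ?E m} = {}"
        by (auto simp: unbroken_Stream H_def)
      then show ?thesis by (metis emeasure_empty zero_le)
    next
      case 3
      then have y: "m < snd y" by (auto simp: G_def)
      then have "{\<omega> \<in> space ?S. y ## \<omega> \<in> ?E m} \<subseteq> ?E (snd y)"
        by (auto simp: unbroken_Stream max_absorb2)
      then have "emeasure ?S {\<omega> \<in> space ?S. y ## \<omega> \<in> ?E m} \<le> ennreal (?\<phi> (snd y))"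
        unfolding S.emeasure_eq_measure[symmetric] by (rule emeasure_mono) measurable
      also have "\<dots> \<le> ennreal s" using y \<open>0 \<le> m\<close> by (intro ennreal_leI s) simp
      finally show ?thesis using 3 by (simp add: A_def G_def)
    qed
  qed
  have "ennreal (?\<phi> m) = (\<integral>\<^sup>+y. emeasure ?S {\<omega> \<in> space ?S. y ## \<omega> \<in> ?E m} \<partial>D)"
    unfolding S.emeasure_eq_measure[symmetric] by (rule D.emeasure_stream_space) measurable
  also have "\<dots> \<le> (\<integral>\<^sup>+y. ennreal (?\<phi> m) * indicator A y + ennreal s * indicator (G - H) y \<partial>D)"
    by (intro nn_integral_mono step)
  also have "\<dots> = ennreal (?\<phi> m) * emeasure D A + ennreal s * emeasure D (G - H)"
    by (simp add: nn_integral_add nn_integral_cmult_indicator)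
  also have "\<dots> = ennreal (?\<phi> m * measure D A + s * measure D (G - H))"
    using s0 by (simp add: D.emeasure_eq_measure ennreal_mult ennreal_plus)
  finally have "?\<phi> m \<le> ?\<phi> m * measure D A + s * measure D (G - H)"
    using s0 by (subst (asm) ennreal_le_iff) auto
  \<comment> \<open>Once the terms in \<open>?\<phi> m\<close> are collected, both sides carry the
    factor \<open>exp (-m)\<close>, which is positive and cancels.\<close>
  then have "exp (-m) * ?\<phi> m \<le> exp (-m) * ((1 - p * exp (-c)) * s)"
    using exp_add[of "-m" "-c"] by (simp add: mA mGH algebra_simps)
  then show ?thesis by simp
qed

lemma AE_not_unbroken:
  fixes D :: "(real \<times> real) measure"
  assumes "prob_space D" and sets_D [measurable_cong]: "sets D = sets (borel \<Otimes>\<^sub>M borel)"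
    and tail: "\<And>a. 0 \<le> a \<Longrightarrow> measure D {y. a < snd y} = exp (-a)"
    and joint: "\<And>a. 0 \<le> a \<Longrightarrow> measure D {y. fst y \<le> c \<and> a < snd y} = p * exp (-a)"
    and "0 \<le> c" "0 < p" "0 \<le> m"
  shows "AE \<omega> in stream_space D. \<not> unbroken m \<omega>"
proof -
  interpret D: prob_space D by fact
  interpret S: prob_space "stream_space D" by (rule D.prob_space_stream_space)
  let ?\<phi> = "\<lambda>m. measure (stream_space D) {\<omega> \<in> space (stream_space D). unbroken m \<omega>}"
  define s where "s = (SUP m\<in>{0..}. ?\<phi> m)"
  have bdd: "bdd_above (?\<phi> ` {0..})" by (rule bdd_aboveI[of _ 1]) auto
  have le: "?\<phi> m \<le> s" if "0 \<le> m" for m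
    unfolding s_def using that by (intro cSUP_upper bdd) simp
  have "s \<le> (1 - p * exp (-c)) * s"
    unfolding s_def
  proof (rule cSUP_least)
    fix m :: real assume "m \<in> {0..}"
    then show "?\<phi> m \<le> (1 - p * exp (-c)) * (SUP m\<in>{0..}. ?\<phi> m)"
      using assms(1-5) le unfolding s_def by (intro prob_unbroken_le) auto
  qed simp
  then have "p * exp (-c) * s \<le> 0" by (simp add: algebra_simps)
  then have "s \<le> 0" using \<open>0 < p\<close> by (simp add: mult_le_0_iff)
  with le[OF \<open>0 \<le> m\<close>] have "?\<phi> m = 0"
    using measure_nonneg[of "stream_space D"] by (intro order_antisym) (auto intro: order_trans)
  then show ?thesis
    by (subst AE_iff_measurable[OF _ refl]) (auto simp: S.emeasure_eq_measure)
qed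

text \<open>Independence makes the joint law a product measure, whose image under
  \<open>to_stream\<close> is the stream space. This carries null events of the stream space back to
  \<open>M\<close>.\<close>

lemma (in prob_space) distr_to_stream:
  assumes "indep_vars (\<lambda>_. N) Y (UNIV :: nat set)" and "\<And>n. distr M N (Y n) = D"
  shows "distr M (stream_space N) (\<lambda>\<omega>. to_stream (\<lambda>n. Y n \<omega>)) = stream_space D"
proof -
  have rv [measurable]: "Y n \<in> measurable M N" for n using assms(1) by (simp add: indep_vars_def)
  have sets_D: "sets D = sets N" by (simp flip: assms(2)[of 0])
  have "distr M (\<Pi>\<^sub>M n\<in>UNIV. N) (\<lambda>\<omega> n. Y n \<omega>) = (\<Pi>\<^sub>M n\<in>UNIV. D)"
    using assms indep_vars_iff_distr_eq_PiM[of UNIV Y "\<lambda>_. N"] by (simp add: restrict_UNIV)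
  then have "stream_space D = distr (distr M (\<Pi>\<^sub>M n\<in>UNIV. N) (\<lambda>\<omega> n. Y n \<omega>)) (stream_space N) to_stream"
    by (subst stream_space_eq_distr)
       (auto intro!: distr_cong sets_stream_space_cong simp: sets_D)
  also have "\<dots> = distr M (stream_space N) (\<lambda>\<omega>. to_stream (\<lambda>n. Y n \<omega>))"
    by (subst distr_distr) (auto simp: comp_def intro!: measurable_PiM_single' measurable_space[OF rv])
  finally show ?thesis by simp
qed

section \<open>Infinite fires\<close>

context fire_env
begin

text \<open>An igniting burning starts at a finite time, and the tree it ignites appears no later
  than a finite duration afterwards.\<close>

lemma fire_burn_finite: "(x, i) \<in> fire \<tau> \<theta> k \<Longrightarrow> burn \<tau> \<theta> x i \<noteq> \<infinity>"
proof (induction x i rule: fire.induct)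
  case start
  show ?case unfolding burn.simps by (induction k) auto
next
  case (spread x i j)
  then show ?case
    using ignitesD[OF spread.hyps(2)] by (auto simp: spreads_def max_def)
qed

text \<open>Fires do not overtake each other. An earlier burning at \<open>Suc x\<close> precedes
  the time \<open>burn \<tau> \<theta> x i\<close>, so it is finite and has an igniter at
  \<open>x\<close>; that igniter burnt before \<open>i\<close>, and the induction hypothesis places
  it in an earlier fire.\<close>

lemma earlier_burning_earlier_fire:
  "(x, i) \<in> fire \<tau> \<theta> k \<Longrightarrow> i' < i \<Longrightarrow> \<exists>k'<k. (x, i') \<in> fire \<tau> \<theta> k'"
proof (induction x i arbitrary: i' rule: fire.induct)
  case start
  then show ?case using fire.start by blast
next
  case (spread x i j j')
  from spread.hyps spread.prems obtain l where j: "j = Suc l" "j' \<le> l" by (cases j) auto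
  have "burn \<tau> \<theta> (Suc x) j' \<le> burn \<tau> \<theta> (Suc x) l" using j(2) by (rule burn_mono)
  also have "\<dots> < burn \<tau> \<theta> x i"
    using ignitesD(1)[OF spread.hyps(2)] j(1) by (simp add: spreads_def prev_burn_def)
  finally have less: "burn \<tau> \<theta> (Suc x) j' < burn \<tau> \<theta> x i" .
  then obtain i' where i': "ignites \<tau> \<theta> x i' j'"
    using burn_Suc_None[of \<tau> \<theta> x j'] by fastforce
  have "burn \<tau> \<theta> x i' < burn \<tau> \<theta> x i"
    using ignitesD(2)[OF i'] less by simp
  then have "i' < i" using burn_mono[of i i' x] by (meson leD not_le)
  with spread.IH obtain k' where "k' < k" "(x, i') \<in> fire \<tau> \<theta> k'" by blast
  then show ?case using i' fire.spread by blast
qed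

text \<open>A fire advances one site at a time, so an infinite fire, known only to reach arbitrarily
  far sites, visits every site.\<close>

lemma fire_leftwards: "(x, i) \<in> fire \<tau> \<theta> k \<Longrightarrow> y \<le> x \<Longrightarrow> \<exists>j. (y, j) \<in> fire \<tau> \<theta> k"
proof (induction x i rule: fire.induct)
  case start
  then show ?case using fire.start by auto
next
  case (spread x i j)
  then show ?case by (metis fire.spread le_Suc_eq)
qed

lemma infinite_fire_unbroken:
  assumes "infinite_fire \<tau> \<theta> k"
  shows "\<exists>X n. unbroken (real n) (to_stream (\<lambda>x. (\<theta> (X + x) 0, \<tau> (Suc (X + x)) 0)))"
proof -
  \<comment> \<open>The least infinite fire replaces the given one, so that all its predecessors are
    finite.\<close>
  obtain k where inf: "infinite_fire \<tau> \<theta> k" and min: "\<And>k'. k' < k \<Longrightarrow> \<not> infinite_fire \<tau> \<theta> k'"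
    using assms exists_least_iff[of "infinite_fire \<tau> \<theta>"] by blast
  then have "\<forall>k'<k. \<exists>n. \<forall>x\<ge>n. \<forall>i. (x, i) \<notin> fire \<tau> \<theta> k'"
    unfolding infinite_fire_def by blast
  then obtain b where b: "\<And>k' x i. k' < k \<Longrightarrow> b k' \<le> x \<Longrightarrow> (x, i) \<notin> fire \<tau> \<theta> k'" by metis
  \<comment> \<open>The sum serves only as a common upper bound of the finitely many
    \<open>b k'\<close>.\<close>
  define X where "X = (\<Sum>k'<k. b k')"
  \<comment> \<open>Otherwise the first burning of \<open>x\<close> would belong to an earlier fire,
    and none of those reaches \<open>x\<close>.\<close>
  have first: "i = 0" if "(x, i) \<in> fire \<tau> \<theta> k" "X \<le> x" for x i
  proof (rule ccontr)
    assume "i \<noteq> 0"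
    with earlier_burning_earlier_fire[OF that(1)] obtain k' where
      k': "k' < k" "(x, 0) \<in> fire \<tau> \<theta> k'" by blast
    then have "b k' \<le> X" unfolding X_def by (intro member_le_sum) auto
    then show False using b k' that(2) order_trans by blast
  qed
  have fire0: "(x, 0) \<in> fire \<tau> \<theta> k" if "X \<le> x" for x
    using inf fire_leftwards first[OF _ that] unfolding infinite_fire_def by metis
  \<comment> \<open>The burning of \<open>Suc x\<close> entered the fire through some burning of
    \<open>x\<close>, which must have index \<open>0\<close> by \<open>first\<close>.\<close>
  have ign: "ignites \<tau> \<theta> x 0 0" if "X \<le> x" for x
    using fire0[of "Suc x"] first[of x] that by (auto elim: fire.cases)
  let ?s = "to_stream (\<lambda>x. (\<theta> (X + x) 0, \<tau> (Suc (X + x)) 0))"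
  have nth: "?s !! x = (\<theta> (X + x) 0, \<tau> (Suc (X + x)) 0)" for x by (simp add: to_stream_def)
  obtain r where r: "burn \<tau> \<theta> X 0 = ereal r"
    using fire_burn_finite[OF fire0[of X]] burn_nonneg[of X 0] by (cases "burn \<tau> \<theta> X 0") auto
  \<comment> \<open>A natural level leaves only countably many events to exclude.\<close>
  obtain n :: nat where n: "r \<le> real n" using real_arch_simple by blast
  have le: "burn \<tau> \<theta> (X + x) 0 \<le> ereal (running_max (real n) ?s x)" for x
  proof (induction x)
    case 0
    then show ?case using r n by simp
  next
    case (Suc x)
    have "burn \<tau> \<theta> (X + Suc x) 0 = max (ereal (\<tau> (Suc (X + x)) 0)) (burn \<tau> \<theta> (X + x) 0)"
      using ignitesD(2)[OF ign[of "X + x"]] by (simp add: appear_def)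
    also have "\<dots> \<le> ereal (running_max (real n) ?s (Suc x))"
      using Suc by (simp add: nth le_max_iff_disj flip: ereal_max)
        (simp add: max.coboundedI1 flip: max_def)
    finally show ?case .
  qed
  \<comment> \<open>The first tree at the next site appears by the ignition time at
    \<open>X + x\<close> or within the burning time after it, and \<open>le\<close> bounds that
    ignition time.\<close>
  have "\<tau> (Suc (X + x)) 0 \<le> running_max (real n) ?s x + \<theta> (X + x) 0" for x
    using ignitesD(1)[OF ign[of "X + x"]] le[of x] theta_nonneg[of "X + x" 0]
    by (cases "burn \<tau> \<theta> (X + x) 0") (auto simp: spreads_def appear_def)
  then have "unbroken (real n) ?s" by (simp add: unbroken_def nth)
  then show ?thesis by blast
qed

end

section \<open>Laws and independence of the pairs, and the almost sure conclusion\<close>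

theorem theorem4p1:
  fixes M :: "'a measure" and N :: "'b measure"
    and \<tau> \<theta> :: "nat \<Rightarrow> nat \<Rightarrow> 'a \<Rightarrow> real" and \<theta>\<^sub>0 :: "'b \<Rightarrow> real"
  assumes "prob_space M" and "prob_space N"
    and "\<theta>\<^sub>0 \<in> borel_measurable N" and "AE \<omega> in N. 0 \<le> \<theta>\<^sub>0 \<omega>"
    and "\<And>x i. distributed M lborel (\<tau> x i) (exponential_density 1)"
    and "\<And>x i. \<theta> x i \<in> borel_measurable M"
    and "\<And>x i. distr M borel (\<theta> x i) = distr N borel \<theta>\<^sub>0"
    and "prob_space.indep_vars M (\<lambda>_. borel)
           (case_sum (\<lambda>(x, i). \<tau> x i) (\<lambda>(x, i). \<theta> x i)) (UNIV :: (nat \<times> nat + nat \<times> nat) set)"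
  shows "AE \<omega> in M. \<forall>k. \<not> infinite_fire (\<lambda>x i. \<tau> x i \<omega>) (\<lambda>x i. \<theta> x i \<omega>) k"
proof -
  interpret prob_space M by fact
  interpret N: prob_space N by fact
  note [measurable] = assms(3,6)
  have [measurable]: "\<tau> x i \<in> borel_measurable M" for x i
    using distributed_measurable[OF assms(5)[of x i]] by simp
  define A where "A = distr N borel \<theta>\<^sub>0"
  define B where "B = distr M borel (\<tau> 0 0)"
  interpret A: prob_space A unfolding A_def by (rule N.prob_space_distr) measurable
  interpret B: prob_space B unfolding B_def by (rule prob_space_distr) measurable
  interpret AB: pair_prob_space A B ..
  have sets_AB [measurable_cong, simp]: "sets A = sets borel" "sets B = sets borel"
    by (simp_all add: A_def B_def)
  have space_AB [simp]: "space A = UNIV" "space B = UNIV" by (simp_all add: A_def B_def)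
  have law_\<tau>: "distr M borel (\<tau> x i) = B" for x i
  proof -
    have "distr M borel (\<tau> x i) = distr M lborel (\<tau> x i)" for x i
      by (rule distr_cong) simp_all
    then show ?thesis
      using distributed_distr_eq_density[OF assms(5)] by (simp add: B_def)
  qed
  have exp_tail: "measure B {a<..} = exp (-a)" if "0 \<le> a" for a
    using exponential_distributedD_gt[OF assms(5) that, of 0 0]
    by (simp add: B_def measure_distr vimage_def Int_def conj_commute)
  \<comment> \<open>Since burning times are real-valued, the half-lines exhaust the line and cannot
    all be null. A natural \<open>c\<close> is automatically nonnegative.\<close>
  have "\<exists>c::nat. 0 < measure A {..real c}"
  proof (rule ccontr)
    assume "\<nexists>c::nat. 0 < measure A {..real c}"
    then have "emeasure A {..real c} = 0" for c :: nat
      by (simp add: A.emeasure_eq_measure zero_less_measure_iff)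
    then have "emeasure A (\<Union>c::nat. {..real c}) = 0"
      by (intro emeasure_UN_eq_0) auto
    moreover have "(\<Union>c::nat. {..real c}) = space A"
      by (auto intro: real_arch_simple)
    ultimately show False using A.emeasure_space_1 by simp
  qed
  then obtain c :: nat where c: "0 < measure A {..real c}" ..
  have rect: "measure (A \<Otimes>\<^sub>M B) (U \<times> V) = measure A U * measure B V"
    if "U \<in> sets borel" "V \<in> sets borel" for U V
    using that by (simp add: measure_def B.emeasure_pair_measure_Times enn2real_mult)
  have null: "AE s in stream_space (A \<Otimes>\<^sub>M B). \<not> unbroken (real n) s" for n
  proof (rule AE_not_unbroken[where c = "real c" and p = "measure A {..real c}"])
    show "measure (A \<Otimes>\<^sub>M B) {y. a < snd y} = exp (-a)" if "0 \<le> a" for a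
    proof -
      have "{y :: real \<times> real. a < snd y} = UNIV \<times> {a<..}" by auto
      then show ?thesis using rect[of UNIV "{a<..}"] exp_tail[OF that] A.prob_space by simp
    qed
    show "measure (A \<Otimes>\<^sub>M B) {y. fst y \<le> real c \<and> a < snd y} = measure A {..real c} * exp (-a)"
      if "0 \<le> a" for a
    proof -
      have "{y. fst y \<le> real c \<and> a < snd y} = {..real c} \<times> {a<..}" by auto
      then show ?thesis using rect[of "{..real c}" "{a<..}"] exp_tail[OF that] by simp
    qed
  qed (use c in \<open>auto intro: AB.prob_space_axioms sets_pair_measure_cong\<close>)
  have not_unbroken:
    "AE \<omega> in M. \<not> unbroken (real n) (to_stream (\<lambda>x. (\<theta> (X + x) 0 \<omega>, \<tau> (Suc (X + x)) 0 \<omega>)))" for X n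
  proof -
    let ?Z = "case_sum (\<lambda>(x, i). \<tau> x i) (\<lambda>(x, i). \<theta> x i)"
    let ?Y = "\<lambda>x \<omega>. (\<theta> (X + x) 0 \<omega>, \<tau> (Suc (X + x)) 0 \<omega>)"
    \<comment> \<open>These index the two variables of pair \<open>x\<close>. The sets
      \<open>{u x, v x}\<close> are disjoint for different \<open>x\<close>, so the pairs are
      independent; \<open>u x\<close> and \<open>v x\<close> differ, so each pair has a product
      law.\<close>
    define u v :: "nat \<Rightarrow> nat \<times> nat + nat \<times> nat"
      where "u x = Inr (X + x, 0)" and "v x = Inl (Suc (X + x), 0)" for x
    have "indep_vars (\<lambda>x. PiM {u x, v x} (\<lambda>_. borel)) (\<lambda>x \<omega>. restrict (\<lambda>i. ?Z i \<omega>) {u x, v x}) UNIV"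
      by (rule indep_vars_restrict[OF assms(8)]) (auto simp: disjoint_family_on_def u_def v_def)
    then have "indep_vars (\<lambda>_. borel \<Otimes>\<^sub>M borel)
        (\<lambda>x \<omega>. (\<lambda>f. (f (u x), f (v x))) (restrict (\<lambda>i. ?Z i \<omega>) {u x, v x})) UNIV"
      by (rule indep_vars_compose2) measurable
    then have ind: "indep_vars (\<lambda>_. borel \<Otimes>\<^sub>M borel) ?Y UNIV"
      by (simp add: u_def v_def)
    have law: "distr M (borel \<Otimes>\<^sub>M borel) (?Y x) = A \<Otimes>\<^sub>M B" for x
    proof -
      have "indep_var (PiM {u x} (\<lambda>_. borel)) (\<lambda>\<omega>. restrict (\<lambda>i. ?Z i \<omega>) {u x})
          (PiM {v x} (\<lambda>_. borel)) (\<lambda>\<omega>. restrict (\<lambda>i. ?Z i \<omega>) {v x})"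
        by (rule indep_var_restrict[OF assms(8)]) (auto simp: u_def v_def)
      then have "indep_var borel ((\<lambda>f. f (u x)) \<circ> (\<lambda>\<omega>. restrict (\<lambda>i. ?Z i \<omega>) {u x}))
          borel ((\<lambda>f. f (v x)) \<circ> (\<lambda>\<omega>. restrict (\<lambda>i. ?Z i \<omega>) {v x}))"
        by (rule indep_var_compose) measurable
      then have "indep_var borel (\<theta> (X + x) 0) borel (\<tau> (Suc (X + x)) 0)"
        by (simp add: u_def v_def comp_def)
      then show ?thesis
        unfolding indep_var_distribution_eq by (simp add: assms(7) law_\<tau> A_def)
    qed
    have "AE s in distr M (stream_space (borel \<Otimes>\<^sub>M borel)) (\<lambda>\<omega>. to_stream (\<lambda>x. ?Y x \<omega>)).
        \<not> unbroken (real n) s"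
      unfolding distr_to_stream[OF ind law] by (rule null)
    moreover have "(\<lambda>\<omega>. to_stream (\<lambda>x. ?Y x \<omega>)) \<in> measurable M (stream_space (borel \<Otimes>\<^sub>M borel))"
      by (rule measurable_stream_space2) (simp add: to_stream_def)
    ultimately show ?thesis by (rule AE_distrD[rotated])
  qed
  \<comment> \<open>The deterministic results need the sign conditions of \<open>fire_env\<close>,
    which hold outside a null set.\<close>
  have "AE \<omega> in M. 0 < \<tau> x i \<omega>" for x i
  proof -
    have "\<P>(\<omega> in M. 0 < \<tau> x i \<omega>) = 1"
      using exponential_distributedD_gt[OF assms(5), of 0 x i] by simp
    then show ?thesis by (subst (asm) prob_Collect_eq_1) auto
  qed
  moreover have "AE \<omega> in M. 0 \<le> \<theta> x i \<omega>" for x i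
  proof -
    have "AE t in distr M borel (\<theta> x i). 0 \<le> t"
      unfolding assms(7) using assms(4) by (subst AE_distr_iff) auto
    then show ?thesis by (subst (asm) AE_distr_iff) auto
  qed
  \<comment> \<open>All quantifiers range over natural numbers, so the exceptional sets together
    form a null set.\<close>
  ultimately have "AE \<omega> in M. (\<forall>x i. 0 < \<tau> x i \<omega>) \<and> (\<forall>x i. 0 \<le> \<theta> x i \<omega>) \<and>
      (\<forall>X n. \<not> unbroken (real n) (to_stream (\<lambda>x. (\<theta> (X + x) 0 \<omega>, \<tau> (Suc (X + x)) 0 \<omega>))))"
    using not_unbroken by (simp add: AE_all_countable)
  then show ?thesis
  proof (rule AE_mp, intro AE_I2 impI allI notI)
    fix \<omega> k
    assume *: "(\<forall>x i. 0 < \<tau> x i \<omega>) \<and> (\<forall>x i. 0 \<le> \<theta> x i \<omega>) \<and>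
        (\<forall>X n. \<not> unbroken (real n) (to_stream (\<lambda>x. (\<theta> (X + x) 0 \<omega>, \<tau> (Suc (X + x)) 0 \<omega>))))"
      and inf: "infinite_fire (\<lambda>x i. \<tau> x i \<omega>) (\<lambda>x i. \<theta> x i \<omega>) k"
    from * interpret fire_env "\<lambda>x i. \<tau> x i \<omega>" "\<lambda>x i. \<theta> x i \<omega>"
      by unfold_locales auto
    show False using infinite_fire_unbroken[OF inf] * by blast
  qed
qed

end
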